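(* Fix $\gamma>1$ and consider a head-on (Group I) interaction of an incoming forward wave of strength $f$ (on the left) and an incoming backward wave of strength $b$ (on the right), of one of the three types: Ia (shock–shock): $f<1<b$; Ib (forward shock, backward rarefaction): $f<1$, $b<1$; Ic (rarefaction–rarefaction): $b<1<f$ (with $b,f>0$). Let $B,C,F$ be the strengths of the outgoing backward, contact, and forward waves. Then: (i) $B>1\Leftrightarrow b>1$ and $B<1\Leftrightarrow b<1$. (ii) $F>1\Leftrightarrow f>1$ and $F<1\Leftrightarrow f<1$. (iii) The outgoing contact satisfies: in Ia interactions, $C>1\Leftrightarrow bf>1$ and $C<1\Leftrightarrow bf<1$; in Ib interactions, $C>1$; in Ic interactions, $C=1$ (no outgoing contact). (iv) A vacuum never forms in Ia and Ib interactions, while in Ic interactions a vacuum occurs if and only if $b^{\zeta}+f^{-\zeta}\le 1$, where $\zeta=\frac{\gamma-1}{2\gamma}$.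
   Context: Fix the adiabatic constant $\gamma>1$ and set $a=\frac{\gamma-1}{\gamma+1}\in(0,1)$, $\kappa=\sqrt{1-a}$, $\nu=\frac{\sqrt{1-a^2}}{a}$, $\zeta=\frac{a}{1+a}=\frac{\gamma-1}{2\gamma}$. The gas is governed by the 1-d Euler system in Lagrangian coordinates, $\tau_t-u_x=0$, $u_t+p_x=0$, $E_t+(up)_x=0$, $E=\frac{p\tau}{\gamma-1}+\frac{u^2}{2}$; states are $U=(\tau,u,p)\in(0,\infty)\times\mathbb{R}\times(0,\infty)$ (specific volume, velocity, pressure). Define on $(0,\infty)$: $\phi_-(q)=q^{-1/\gamma}$ for $q\le 1$, $\phi_-(q)=\frac{1+aq}{q+a}$ for $q>1$; $\psi_-(q)=\nu(q^\zeta-1)$ for $q\le 1$, $\psi_-(q)=\frac{\kappa(q-1)}{\sqrt{q+a}}$ for $q>1$; $\phi_+(q)=\frac{1+aq}{q+a}$ for $q\le 1$, $\phi_+(q)=q^{-1/\gamma}$ for $q>1$; $\psi_+(q)=\frac{\kappa(q-1)}{\sqrt{q+a}}$ for $q\le1$, $\psi_+(q)=\nu(q^\zeta-1)$ for $q>1$. Wave curves: for a state $\bar U=(\bar\tau,\bar u,\bar p)$ on the left, the state on the right of a single wave is backward wave of strength $b>0$: $W_-(b;\bar U)=(\phi_-(b)\bar\tau,\ \bar u-\psi_-(b)\sqrt{\bar\tau\bar p},\ b\bar p)$ (rarefaction if $b<1$, shock if $b>1$); contact of strength $c>0$: $J(c;\bar U)=(c\bar\tau,\bar u,\bar p)$;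 forward wave of strength $f>0$: $W_+(f;\bar U)=(\phi_+(f)\bar\tau,\ \bar u+\psi_+(f)\sqrt{\bar\tau\bar p},\ f\bar p)$ (shock if $f<1$, rarefaction if $f>1$). Riemann problem $(U_l,U_r)$, with $U_l=(\tau_l,u_l,p_l)$, $U_r=(\tau_r,u_r,p_r)$: the outgoing strengths are the numbers $B,C,F>0$ with $U_r=W_+(F;J(C;W_-(B;U_l)))$; they exist (and are unique) if and only if $u_r-u_l<\frac{2}{\gamma-1}\left(\sqrt{\gamma\tau_l p_l}+\sqrt{\gamma\tau_r p_r}\right)$. If this inequality fails, a vacuum is said to form; then the outgoing backward and forward waves are both rarefactions reaching the vacuum, which is recorded as $B<1$ and $F>1$ (formally $B=0$, $F=+\infty$), and $C$ records the entropy jump across the vacuum: $C:=\left(\frac{p_r\tau_r^\gamma}{p_l\tau_l^\gamma}\right)^{1/\gamma}$ (so $C\gtrless1$ iff the specific entropy on the right is larger/smaller than on the left). Head-on interaction with incoming strengths $f,b$: the outgoing waves are those of the Riemann problem $(U_l,U_r)$ with $U_m=W_+(f;U_l)$ and $U_r=W_-(b;U_m)$. The outgoing strengths and the occurrence of a vacuum depend only on $f,b,\gamma$, not on $U_l$. *)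

theory Defs
  imports Complex_Main "HOL-Library.Extended_Real"
begin

text \<open>
  Waves and Riemann problems for the 1-d Euler system of an ideal gas with adiabatic constant
  \<open>\<gamma> > 1\<close>, in Lagrangian coordinates.  A state is a triple of specific volume, velocity and pressure.
\<close>

type_synonym state = "real \<times> real \<times> real"

definition states :: "state set" where
  "states = {(\<tau>, u, p). 0 < \<tau> \<and> 0 < p}"

definition acoef :: "real \<Rightarrow> real" where
  "acoef \<gamma> = (\<gamma> - 1) / (\<gamma> + 1)"

definition kappa :: "real \<Rightarrow> real" where
  "kappa \<gamma> = sqrt (1 - acoef \<gamma>)"

definition nu :: "real \<Rightarrow> real" where
  "nu \<gamma> = sqrt (1 - (acoef \<gamma>)\<^sup>2) / acoef \<gamma>"

text \<open>Equivalently \<open>acoef \<gamma> / (1 + acoef \<gamma>)\<close>.\<close>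

definition zeta :: "real \<Rightarrow> real" where
  "zeta \<gamma> = (\<gamma> - 1) / (2 * \<gamma>)"

definition phi_minus :: "real \<Rightarrow> real \<Rightarrow> real" where
  "phi_minus \<gamma> q =
    (if q \<le> 1 then q powr (- 1 / \<gamma>) else (1 + acoef \<gamma> * q) / (q + acoef \<gamma>))"

definition psi_minus :: "real \<Rightarrow> real \<Rightarrow> real" where
  "psi_minus \<gamma> q =
    (if q \<le> 1 then nu \<gamma> * (q powr zeta \<gamma> - 1) else kappa \<gamma> * (q - 1) / sqrt (q + acoef \<gamma>))"

definition phi_plus :: "real \<Rightarrow> real \<Rightarrow> real" where
  "phi_plus \<gamma> q =
    (if q \<le> 1 then (1 + acoef \<gamma> * q) / (q + acoef \<gamma>) else q powr (- 1 / \<gamma>))"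

definition psi_plus :: "real \<Rightarrow> real \<Rightarrow> real" where
  "psi_plus \<gamma> q =
    (if q \<le> 1 then kappa \<gamma> * (q - 1) / sqrt (q + acoef \<gamma>) else nu \<gamma> * (q powr zeta \<gamma> - 1))"

text \<open>
  Each of the following maps the state on the left of a single wave of the given strength
  to the state on its right.
\<close>

definition W_minus :: "real \<Rightarrow> real \<Rightarrow> state \<Rightarrow> state" where
  "W_minus \<gamma> b = (\<lambda>(\<tau>, u, p). (phi_minus \<gamma> b * \<tau>, u - psi_minus \<gamma> b * sqrt (\<tau> * p), b * p))"

definition J :: "real \<Rightarrow> state \<Rightarrow> state" where
  "J c = (\<lambda>(\<tau>, u, p). (c * \<tau>, u, p))"

definition W_plus :: "real \<Rightarrow> real \<Rightarrow> state \<Rightarrow> state" where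
  "W_plus \<gamma> f = (\<lambda>(\<tau>, u, p). (phi_plus \<gamma> f * \<tau>, u + psi_plus \<gamma> f * sqrt (\<tau> * p), f * p))"

definition vacuum :: "real \<Rightarrow> state \<Rightarrow> state \<Rightarrow> bool" where
  "vacuum \<gamma> Ul Ur \<longleftrightarrow>
    (case (Ul, Ur) of ((\<tau>l, ul, pl), (\<tau>r, ur, pr)) \<Rightarrow>
      \<not> ur - ul < 2 / (\<gamma> - 1) * (sqrt (\<gamma> * \<tau>l * pl) + sqrt (\<gamma> * \<tau>r * pr)))"

text \<open>
  \<open>outgoing \<gamma> Ul Ur B C F\<close>: the Riemann problem \<open>(Ul, Ur)\<close> is resolved by a backward wave,
  a contact and a forward wave of strengths \<open>B\<close>, \<open>C\<close>, \<open>F\<close>.  If a vacuum forms, the outer waves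
  are rarefactions reaching the vacuum, recorded by \<open>B = 0\<close> and \<open>F = \<infinity>\<close> (hence the type
  of \<open>F\<close>), and \<open>C\<close> records the entropy jump across the vacuum.
\<close>

definition outgoing :: "real \<Rightarrow> state \<Rightarrow> state \<Rightarrow> real \<Rightarrow> real \<Rightarrow> ereal \<Rightarrow> bool" where
  "outgoing \<gamma> Ul Ur B C F \<longleftrightarrow>
    (if vacuum \<gamma> Ul Ur
     then B = 0 \<and> F = \<infinity> \<and>
       (case (Ul, Ur) of ((\<tau>l, ul, pl), (\<tau>r, ur, pr)) \<Rightarrow>
         C = ((pr * \<tau>r powr \<gamma>) / (pl * \<tau>l powr \<gamma>)) powr (1 / \<gamma>))
     else 0 < B \<and> 0 < C \<and>
       (\<exists>F'. 0 < F' \<and> F = ereal F' \<and> Ur = W_plus \<gamma> F' (J C (W_minus \<gamma> B Ul))))"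

text \<open>
  Types of head-on interactions of an incoming forward wave of strength \<open>f\<close> (on the left) and
  an incoming backward wave of strength \<open>b\<close> (on the right).
\<close>

definition Ia :: "real \<Rightarrow> real \<Rightarrow> bool" where
  "Ia f b \<longleftrightarrow> 0 < f \<and> f < 1 \<and> 1 < b"

definition Ib :: "real \<Rightarrow> real \<Rightarrow> bool" where
  "Ib f b \<longleftrightarrow> 0 < f \<and> f < 1 \<and> 0 < b \<and> b < 1"

definition Ic :: "real \<Rightarrow> real \<Rightarrow> bool" where
  "Ic f b \<longleftrightarrow> 0 < b \<and> b < 1 \<and> 1 < f"

end

theory Submission
  imports Defs
begin

text \<open>
  Everything is measured from the middle state \<open>Um\<close> between the two incoming waves.  A forward wave
  of strength \<open>f\<close> read from its right side is a backward wave of strength \<open>1 / f\<close> read from its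
  left side (lemmas \<open>phi_plus_reflect\<close> and \<open>psi_plus_reflect\<close>), so with \<open>g = 1 / f\<close>, \<open>G = 1 / F\<close>
  only the functions \<open>\<phi> = phi_minus\<close> and \<open>\<psi> = psi_minus\<close> remain and the problem becomes symmetric
  under \<open>(g, G) \<leftrightarrow> (b, B)\<close>.  With \<open>h q = sqrt (q * \<phi> q)\<close>, the outgoing waves are characterised by

    \<open>B g = G b\<close>,
    \<open>h(g) \<psi>(B) + h(b) \<psi>(G) = \<psi>(g) + \<psi>(b)\<close>,
    \<open>C = \<phi>(b) \<phi>(G) / (\<phi>(g) \<phi>(B))\<close>.

  The common value \<open>x\<close> of \<open>B g\<close> and \<open>G b\<close> is the pressure between the outgoing waves, divided by that
  of \<open>Um\<close>.  The left side of the second equation, with \<open>B = x / g\<close> and \<open>G = x / b\<close>, is strictly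
  increasing in \<open>x\<close>; hence any question about the position of \<open>B\<close> or \<open>G\<close> relative to a given value is
  answered by evaluating this left side at a single trial pressure (\<open>resolves_compare\<close>).

  The trial pressure \<open>x = g\<close> (that is, \<open>B = 1\<close>) decides the type of the transmitted backward wave:
  the sign needed is that of \<open>\<psi>(g) + \<psi>(b) - h(b) \<psi>(g / b)\<close>, which agrees with the sign of \<open>b - 1\<close>
  (\<open>velocity_jump_behind_shock\<close>, \<open>velocity_jump_behind_rarefaction\<close>).  The forward wave follows by
  symmetry.

  The trial pressure \<open>x = b g\<close> (that is, \<open>B = b\<close>, \<open>G = g\<close>) tells whether a wave is strengthened or
  weakened by the interaction, and this governs the contact.  Two shocks weaken each other, and
  a monotonicity property of the shock adiabat gives the sign of \<open>C - 1\<close>.  A shock meeting a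
  rarefaction is strengthened; rarefactions are isentropic and a stronger shock produces more
  entropy, so \<open>C > 1\<close>.  Two rarefactions produce no entropy at all, so \<open>C = 1\<close>.

  In these variables vacuum formation is the inequality
  \<open>nu (h(g) + h(b)) \<le> - (\<psi>(g) + \<psi>(b))\<close> (\<open>vacuum_iff\<close>), which a shock makes impossible and which for
  two rarefactions is linear in \<open>g\<close> and \<open>b\<close> raised to the power \<open>zeta\<close>.
\<close>

section \<open>Normalised form of the interaction\<close>

text \<open>
  Across a backward wave of strength \<open>q\<close> the quantity \<open>sqrt (\<tau> * p)\<close>, which is proportional to the
  Eulerian sound speed, is multiplied by this factor.
\<close>

definition sound_ratio :: "real \<Rightarrow> real \<Rightarrow> real" where
  "sound_ratio \<gamma> q = sqrt (q * phi_minus \<gamma> q)"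

text \<open>
  The pressure and velocity conditions for the strengths \<open>1 / G\<close> and \<open>B\<close> emerging from the collision of a
  forward wave of strength \<open>1 / g\<close> with a backward wave of strength \<open>b\<close>.  Velocities are in units of
  \<open>sqrt (\<tau> * p)\<close> at the middle state.
\<close>

definition resolves :: "real \<Rightarrow> real \<Rightarrow> real \<Rightarrow> real \<Rightarrow> real \<Rightarrow> bool" where
  "resolves \<gamma> g b G B \<longleftrightarrow> 0 < g \<and> 0 < b \<and> 0 < G \<and> 0 < B \<and> B * g = G * b \<and>
     sound_ratio \<gamma> g * psi_minus \<gamma> B + sound_ratio \<gamma> b * psi_minus \<gamma> G
       = psi_minus \<gamma> g + psi_minus \<gamma> b"

lemma resolves_sym: "resolves \<gamma> g b G B \<longleftrightarrow> resolves \<gamma> b g B G"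
  by (auto simp: resolves_def)

text \<open>
  The specific volumes of the two outer states force this value of the contact strength.
\<close>

definition contact :: "real \<Rightarrow> real \<Rightarrow> real \<Rightarrow> real \<Rightarrow> real \<Rightarrow> real" where
  "contact \<gamma> g b G B = phi_minus \<gamma> b * phi_minus \<gamma> G / (phi_minus \<gamma> g * phi_minus \<gamma> B)"

lemma contact_swap: "contact \<gamma> b g B G = 1 / contact \<gamma> g b G B"
  by (simp add: contact_def)

section \<open>The wave functions\<close>

context
  fixes \<gamma> :: real
  assumes gamma: "\<gamma> > 1"
begin

lemma acoef_bounds: "0 < acoef \<gamma>" "acoef \<gamma> < 1"
  using gamma by (auto simp: acoef_def field_simps)

lemma kappa_pos: "kappa \<gamma> > 0"
  using acoef_bounds by (simp add: kappa_def)

text \<open>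
  In this form \<open>nu\<close> is recognisable as the coefficient in the vacuum condition.
\<close>

lemma nu_eq: "nu \<gamma> = 2 * sqrt \<gamma> / (\<gamma> - 1)"
proof -
  have "1 - (acoef \<gamma>)\<^sup>2 = 4 * \<gamma> / (\<gamma> + 1)\<^sup>2"
    using gamma by (simp add: acoef_def power_divide field_simps) (simp add: power2_eq_square algebra_simps)
  hence "sqrt (1 - (acoef \<gamma>)\<^sup>2) = 2 * sqrt \<gamma> / (\<gamma> + 1)"
    using gamma by (simp add: real_sqrt_divide real_sqrt_mult)
  thus ?thesis
    using gamma by (simp add: nu_def acoef_def field_simps)
qed

lemma nu_pos: "nu \<gamma> > 0"
  using gamma by (simp add: nu_eq)

lemma zeta_bounds: "0 < zeta \<gamma>" "zeta \<gamma> < 1 / 2"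
  using gamma by (auto simp: zeta_def field_simps)

lemma phi_minus_pos: "q > 0 \<Longrightarrow> phi_minus \<gamma> q > 0"
  using acoef_bounds by (auto simp: phi_minus_def intro!: divide_pos_pos add_pos_pos)

text \<open>
  Seen from its right side, a forward wave of strength \<open>q\<close> is a backward wave of strength \<open>1 / q\<close>.
\<close>

lemma phi_plus_reflect:
  assumes "q > 0"
  shows "phi_plus \<gamma> q = 1 / phi_minus \<gamma> (1 / q)"
proof -
  have "(1 + acoef \<gamma> * (1 / q)) / (1 / q + acoef \<gamma>) = (q + acoef \<gamma>) / (1 + acoef \<gamma> * q)"
  proof -
    have "1 + acoef \<gamma> * (1 / q) = (q + acoef \<gamma>) / q" "1 / q + acoef \<gamma> = (1 + acoef \<gamma> * q) / q"
      using assms by (simp_all add: field_simps)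
    thus ?thesis using assms by simp
  qed
  thus ?thesis
    using assms acoef_bounds
    by (cases "q = 1") (auto simp: phi_plus_def phi_minus_def powr_divide powr_minus_divide)
qed

lemma sound_ratio_pos: "q > 0 \<Longrightarrow> sound_ratio \<gamma> q > 0"
  using phi_minus_pos by (simp add: sound_ratio_def)

lemma sound_ratio_rarefaction: "0 < q \<Longrightarrow> q \<le> 1 \<Longrightarrow> sound_ratio \<gamma> q = q powr zeta \<gamma>"
proof -
  assume q: "0 < q" "q \<le> 1"
  have "q * q powr (- 1 / \<gamma>) = q powr (1 + - 1 / \<gamma>)"
    using q by (subst powr_add) simp
  also have "1 + - 1 / \<gamma> = zeta \<gamma> + zeta \<gamma>"
    using gamma by (simp add: zeta_def field_simps)
  also have "q powr \<dots> = (q powr zeta \<gamma>)\<^sup>2"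
    by (simp only: powr_add power2_eq_square)
  finally show ?thesis
    using q by (simp add: sound_ratio_def phi_minus_def)
qed

lemma sound_ratio_shock:
  "q > 1 \<Longrightarrow> sound_ratio \<gamma> q = sqrt (q * (1 + acoef \<gamma> * q) / (q + acoef \<gamma>))"
  by (simp add: sound_ratio_def phi_minus_def)

lemma sound_ratio_gt_1: "q > 1 \<Longrightarrow> sound_ratio \<gamma> q > 1"
proof -
  assume q: "q > 1"
  have "acoef \<gamma> * 1 < acoef \<gamma> * (q * q)"
    using q acoef_bounds by (intro mult_strict_left_mono) (auto simp: less_1_mult)
  hence "q * (1 + acoef \<gamma> * q) / (q + acoef \<gamma>) > 1"
    using q acoef_bounds by (simp add: field_simps)
  thus ?thesis
    using q by (simp add: sound_ratio_shock)
qed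

lemma sound_ratio_lt_1: "0 < q \<Longrightarrow> q < 1 \<Longrightarrow> sound_ratio \<gamma> q < 1"
  using zeta_bounds powr_less_mono2[of "zeta \<gamma>" q 1] by (simp add: sound_ratio_rarefaction)

text \<open>
  The velocity counterpart of \<open>phi_plus_reflect\<close>.  The factor \<open>sound_ratio\<close> appears because the velocity
  jump is measured by the sound speed on the left of the wave for \<open>psi_plus\<close>, on its right
  for the reflected wave.
\<close>

lemma psi_plus_reflect:
  assumes "q > 0"
  shows "psi_plus \<gamma> (1 / q) * sound_ratio \<gamma> q = - psi_minus \<gamma> q"
proof (cases "q > 1")
  case True
  have eq: "1 / q + acoef \<gamma> = (1 + acoef \<gamma> * q) / q"
    using True by (simp add: field_simps)
  have pos: "1 + acoef \<gamma> * q > 0" "q + acoef \<gamma> > 0"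
    using True acoef_bounds by (auto intro: add_pos_pos)
  have "psi_plus \<gamma> (1 / q) * sound_ratio \<gamma> q
      = kappa \<gamma> * (1 / q - 1) / (sqrt (1 + acoef \<gamma> * q) / sqrt q)
        * (sqrt q * sqrt (1 + acoef \<gamma> * q) / sqrt (q + acoef \<gamma>))"
    using True by (simp add: psi_plus_def sound_ratio_shock eq real_sqrt_divide real_sqrt_mult)
  also have "\<dots> = kappa \<gamma> * (1 / q - 1) * (sqrt q * sqrt q) / sqrt (q + acoef \<gamma>)"
  proof -
    have "sqrt (1 + acoef \<gamma> * q) \<noteq> 0" using pos by simp
    thus ?thesis by simp
  qed
  also have "\<dots> = - (kappa \<gamma> * (q - 1) / sqrt (q + acoef \<gamma>))"
    using True by (simp add: left_diff_distrib right_diff_distrib diff_divide_distrib)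
  finally show ?thesis
    using True by (simp add: psi_minus_def)
next
  case False
  show ?thesis
  proof (cases "q = 1")
    case True
    thus ?thesis by (simp add: psi_plus_def psi_minus_def)
  next
    case ne: False
    have "1 / q > 1" using False ne assms by simp
    thus ?thesis using False assms
      by (simp add: psi_plus_def psi_minus_def sound_ratio_rarefaction powr_divide field_simps)
  qed
qed

lemma psi_minus_1 [simp]: "psi_minus \<gamma> 1 = 0"
  by (simp add: psi_minus_def)

lemma psi_minus_strict_mono:
  assumes "0 < x" "x < y"
  shows "psi_minus \<gamma> x < psi_minus \<gamma> y"
proof -
  have raref: "psi_minus \<gamma> x < psi_minus \<gamma> y" if "0 < x" "x < y" "y \<le> 1" for x y
    using that nu_pos zeta_bounds powr_less_mono2[of "zeta \<gamma>" x y] by (simp add: psi_minus_def)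
  have shock: "psi_minus \<gamma> x < psi_minus \<gamma> y" if "1 \<le> x" "x < y" for x y
  proof -
    let ?a = "acoef \<gamma>"
    \<comment> \<open>In this form both terms visibly increase with \<open>q\<close>.\<close>
    have form: "psi_minus \<gamma> q = kappa \<gamma> * (sqrt (q + ?a) - (1 + ?a) / sqrt (q + ?a))" if "q \<ge> 1" for q
    proof -
      have "q + ?a > 0" using that acoef_bounds by simp
      hence "sqrt (q + ?a) * sqrt (q + ?a) = q + ?a" "sqrt (q + ?a) > 0" by auto
      thus ?thesis using that by (auto simp: psi_minus_def field_simps)
    qed
    have "sqrt (x + ?a) < sqrt (y + ?a)" "0 < sqrt (x + ?a)" using that acoef_bounds by auto
    moreover from this have "(1 + ?a) / sqrt (y + ?a) < (1 + ?a) / sqrt (x + ?a)"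
      using acoef_bounds by (intro divide_strict_left_mono) auto
    ultimately have "sqrt (x + ?a) - (1 + ?a) / sqrt (x + ?a) < sqrt (y + ?a) - (1 + ?a) / sqrt (y + ?a)"
      by linarith
    thus ?thesis using that form[of x] form[of y] kappa_pos by simp
  qed
  show ?thesis
  proof (cases "x < 1 \<and> 1 < y")
    case True
    thus ?thesis using raref[of x 1] shock[of 1 y] assms by simp
  next
    case False
    thus ?thesis using raref[of x y] shock[of x y] assms by linarith
  qed
qed

lemma psi_minus_pos: "q > 1 \<Longrightarrow> psi_minus \<gamma> q > 0"
  using psi_minus_strict_mono[of 1 q] by simp

lemma psi_minus_neg: "0 < q \<Longrightarrow> q < 1 \<Longrightarrow> psi_minus \<gamma> q < 0"
  using psi_minus_strict_mono[of q 1] by simp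

text \<open>
  This is why a rarefaction that crosses a shock of the opposite family remains a rarefaction.
  The term \<open>- nu * q powr (- zeta)\<close> increases, and \<open>psi_minus q * q powr (- zeta)\<close> does not decrease
  because \<open>psi_minus q / sqrt q\<close> does not and \<open>zeta < 1 / 2\<close>.
\<close>

lemma shock_relative_to_rarefaction_mono:
  assumes "1 < x" "x < y"
  shows "(psi_minus \<gamma> x - nu \<gamma>) * x powr (- zeta \<gamma>) < (psi_minus \<gamma> y - nu \<gamma>) * y powr (- zeta \<gamma>)"
proof -
  let ?a = "acoef \<gamma>" and ?z = "zeta \<gamma>"
  \<comment> \<open>Three nonnegative nondecreasing factors.\<close>
  have form: "psi_minus \<gamma> q * q powr (- ?z)
      = kappa \<gamma> * (sqrt ((q - 1) / q) * sqrt ((q - 1) / (q + ?a)) * q powr (1 / 2 - ?z))"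
    if "q > 1" for q
  proof -
    have "q powr (1 / 2 - ?z) = sqrt q * q powr (- ?z)"
      using that powr_add[of q "1/2" "- ?z"] by (simp add: powr_half_sqrt)
    moreover have "sqrt (q - 1) * sqrt (q - 1) = q - 1" "sqrt q > 0" using that by auto
    ultimately show ?thesis
      using that acoef_bounds by (simp add: psi_minus_def real_sqrt_divide field_simps)
  qed
  have "sqrt ((x - 1) / x) \<le> sqrt ((y - 1) / y)"
    using assms by (simp add: field_simps)
  moreover have "sqrt ((x - 1) / (x + ?a)) \<le> sqrt ((y - 1) / (y + ?a))"
  proof -
    have "(x - 1) * (y + ?a) \<le> (y - 1) * (x + ?a)"
    proof -
      have "(1 + ?a) * (y - x) \<ge> 0" using assms acoef_bounds by simp
      thus ?thesis by (simp add: algebra_simps)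
    qed
    thus ?thesis using assms acoef_bounds by (simp add: field_simps)
  qed
  moreover have "x powr (1 / 2 - ?z) \<le> y powr (1 / 2 - ?z)"
    using assms zeta_bounds by (intro powr_mono2) auto
  ultimately have
    "psi_minus \<gamma> x * x powr (- ?z) \<le> psi_minus \<gamma> y * y powr (- ?z)"
    using assms kappa_pos acoef_bounds unfolding form[OF assms(1)] form[OF less_trans[OF assms]]
    by (intro mult_left_mono mult_mono) auto
  moreover have "nu \<gamma> * y powr (- ?z) < nu \<gamma> * x powr (- ?z)"
    using assms zeta_bounds nu_pos by (intro mult_strict_left_mono powr_less_mono2_neg) auto
  ultimately show ?thesis by (simp add: algebra_simps)
qed

section \<open>Sign of the velocity defect at the trial pressure where the backward wave vanishes\<close>

text \<open>
  The three cases have different reasons.  If \<open>g \<le> 1\<close>, both sides are affine in \<open>t = g powr zeta\<close>, so the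
  inequality has only to be checked at \<open>t = 0\<close> and \<open>t = 1\<close>, where it comes from \<open>sound_ratio b > 1\<close> and
  from \<open>b powr (- zeta) < 1\<close>.  If \<open>1 < g \<le> b\<close>, the signs of the terms suffice.  If \<open>b < g\<close>, all three
  waves are shocks and already \<open>sound_ratio b * psi_minus (g / b) \<le> psi_minus g\<close>: both sides are a
  multiple of a square root, and \<open>g - b \<le> g - 1\<close> as well as the radicands compare the right way.
\<close>

lemma velocity_jump_behind_shock:
  assumes "b > 1" "g > 0"
  shows "sound_ratio \<gamma> b * psi_minus \<gamma> (g / b) < psi_minus \<gamma> g + psi_minus \<gamma> b"
proof -
  let ?a = "acoef \<gamma>" and ?z = "zeta \<gamma>" and ?h = "sound_ratio \<gamma> b"
  have h: "?h > 1" using assms by (simp add: sound_ratio_gt_1)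
  have pb: "psi_minus \<gamma> b > 0" using assms by (simp add: psi_minus_pos)
  consider "g \<le> 1" | "1 < g" "g \<le> b" | "b < g" by linarith
  thus ?thesis
  proof cases
    case 1
    define t where "t = g powr ?z"
    define s where "s = b powr (- ?z)"
    have t: "0 \<le> t" "t \<le> 1"
      using 1 assms zeta_bounds powr_mono2[of ?z g 1] by (auto simp: t_def)
    have s: "0 < s" "s < 1"
      using assms zeta_bounds powr_less_mono2_neg[of "- ?z" 1 b] by (auto simp: s_def)
    have "t * (?h * s - 1) \<le> ?h - 1"
    proof (cases "?h * s - 1 \<ge> 0")
      case True
      hence "t * (?h * s - 1) \<le> 1 * (?h * s - 1)" using t by (intro mult_right_mono) auto
      also have "?h * s \<le> ?h * 1" using s h by (intro mult_left_mono) auto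
      finally show ?thesis by simp
    next
      case False
      hence "t * (?h * s - 1) \<le> 0" using t by (intro mult_nonneg_nonpos) auto
      thus ?thesis using h by simp
    qed
    hence "?h * (t * s - 1) \<le> t - 1" by (simp add: algebra_simps)
    hence "?h * (nu \<gamma> * (t * s - 1)) \<le> nu \<gamma> * (t - 1)"
      using nu_pos by (simp add: mult.left_commute)
    moreover have "psi_minus \<gamma> (g / b) = nu \<gamma> * (t * s - 1)"
      using 1 assms by (simp add: psi_minus_def t_def s_def powr_divide powr_minus_divide)
    moreover have "psi_minus \<gamma> g = nu \<gamma> * (t - 1)" using 1 by (simp add: psi_minus_def t_def)
    ultimately show ?thesis using pb by simp
  next
    case 2
    have "psi_minus \<gamma> (g / b) \<le> 0"
      using 2 assms psi_minus_neg[of "g / b"] by (cases "g = b") auto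
    hence "?h * psi_minus \<gamma> (g / b) \<le> 0" using h by (intro mult_nonneg_nonpos) auto
    thus ?thesis using pb psi_minus_pos[of g] 2 by linarith
  next
    case 3
    have pos: "b + ?a > 0" "g + ?a > 0" "1 + ?a * b > 0" "g + ?a * b > 0"
      using assms 3 acoef_bounds by (auto intro!: add_pos_pos)
    have "?h * psi_minus \<gamma> (g / b)
        = kappa \<gamma> * (g - b) * sqrt ((1 + ?a * b) / ((b + ?a) * (g + ?a * b)))"
    proof -
      have 1: "g / b + ?a = (g + ?a * b) / b" and 2: "g / b - 1 = (g - b) / b"
        using assms by (auto simp: field_simps)
      have cancel: "(r * s / t) * (k * ((g - b) / b) / (w / r)) = k * (g - b) * (s / (t * w))"
        if "r * r = b" for k r s t w :: real
      proof -
        have "(r * s / t) * (k * ((g - b) / b) / (w / r)) = (r * r / b) * (k * (g - b) * (s / (t * w)))"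
          by (simp add: mult_ac)
        thus ?thesis using that assms by simp
      qed
      have "?h = sqrt b * sqrt (1 + ?a * b) / sqrt (b + ?a)"
        using assms by (simp add: sound_ratio_shock real_sqrt_mult real_sqrt_divide)
      moreover have "psi_minus \<gamma> (g / b) = kappa \<gamma> * ((g - b) / b) / (sqrt (g + ?a * b) / sqrt b)"
        using assms 3 by (simp add: psi_minus_def 1 2 real_sqrt_divide)
      ultimately show ?thesis
        using assms cancel[of "sqrt b"] by (simp only: real_sqrt_divide real_sqrt_mult) simp
    qed
    also have "\<dots> \<le> kappa \<gamma> * (g - 1) * sqrt (1 / (g + ?a))"
    proof -
      have "0 \<le> g * (b - 1) * (1 - ?a) + ?a * (b * b - 1)"
        using assms 3 acoef_bounds less_1_mult[of b b] by (intro add_nonneg_nonneg mult_nonneg_nonneg) auto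
      also have "\<dots> = (b + ?a) * (g + ?a * b) - (1 + ?a * b) * (g + ?a)"
        by (simp add: algebra_simps)
      finally have "(1 + ?a * b) / ((b + ?a) * (g + ?a * b)) \<le> 1 / (g + ?a)"
        using pos by (simp add: divide_le_eq le_divide_eq mult.commute)
      thus ?thesis
        using assms 3 kappa_pos pos by (intro mult_mono real_sqrt_le_mono) auto
    qed
    also have "\<dots> = psi_minus \<gamma> g"
      using assms 3 by (simp add: psi_minus_def real_sqrt_divide)
    finally show ?thesis using pb by simp
  qed
qed

text \<open>
  For \<open>g \<le> 1\<close> the power laws or the signs suffice.  For \<open>g > 1\<close> the claim, divided by \<open>g powr zeta\<close>, is
  \<open>shock_relative_to_rarefaction_mono\<close> for the strengths \<open>g < g / b\<close>.
\<close>

lemma velocity_jump_behind_rarefaction: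
  assumes "0 < b" "b < 1" "g > 0"
  shows "sound_ratio \<gamma> b * psi_minus \<gamma> (g / b) > psi_minus \<gamma> g + psi_minus \<gamma> b"
proof -
  let ?z = "zeta \<gamma>"
  have h: "sound_ratio \<gamma> b = b powr ?z" and hp: "b powr ?z > 0"
    using assms by (simp_all add: sound_ratio_rarefaction)
  have pb: "psi_minus \<gamma> b = nu \<gamma> * (b powr ?z - 1)" using assms by (simp add: psi_minus_def)
  have pbn: "psi_minus \<gamma> b < 0" using assms psi_minus_neg by simp
  consider "g \<le> b" | "b < g" "g \<le> 1" | "1 < g" by linarith
  thus ?thesis
  proof cases
    case 1
    have "b powr ?z * psi_minus \<gamma> (g / b) = nu \<gamma> * (g powr ?z - b powr ?z)"
      using 1 assms hp by (simp add: psi_minus_def powr_divide field_simps)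
    moreover have "psi_minus \<gamma> g = nu \<gamma> * (g powr ?z - 1)" using 1 assms by (simp add: psi_minus_def)
    ultimately show ?thesis using pbn unfolding h pb by (simp add: algebra_simps)
  next
    case 2
    have "b powr ?z * psi_minus \<gamma> (g / b) > 0"
      using hp 2 assms psi_minus_pos[of "g / b"] by (intro mult_pos_pos) auto
    moreover have "psi_minus \<gamma> g \<le> 0" using psi_minus_neg[of g] 2 assms by (cases "g = 1") auto
    ultimately show ?thesis using pbn unfolding h by linarith
  next
    case 3
    have gb: "g < g / b" using assms by (simp add: field_simps)
    have "g powr ?z * ((psi_minus \<gamma> g - nu \<gamma>) * g powr (- ?z))
        < g powr ?z * ((psi_minus \<gamma> (g / b) - nu \<gamma>) * (g / b) powr (- ?z))"
      using shock_relative_to_rarefaction_mono[OF 3 gb] 3 by (intro mult_strict_left_mono) auto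
    moreover have "g powr ?z * ((psi_minus \<gamma> g - nu \<gamma>) * g powr (- ?z)) = psi_minus \<gamma> g - nu \<gamma>"
      using 3 by (simp add: powr_minus)
    moreover have "g powr ?z * ((psi_minus \<gamma> (g / b) - nu \<gamma>) * (g / b) powr (- ?z))
        = (psi_minus \<gamma> (g / b) - nu \<gamma>) * b powr ?z"
      using 3 assms by (simp add: powr_divide powr_minus)
    ultimately have "psi_minus \<gamma> g - nu \<gamma> < (psi_minus \<gamma> (g / b) - nu \<gamma>) * b powr ?z"
      by simp
    thus ?thesis unfolding h pb by (simp add: algebra_simps)
  qed
qed

section \<open>Strengths of the transmitted waves\<close>

text \<open>
  Trial values \<open>x\<close> of the outgoing pressure, relative to the middle state, lie below or above the
  actual value \<open>B * g\<close> according to the sign of the velocity defect that they produce.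
\<close>

lemma resolves_compare:
  assumes r: "resolves \<gamma> g b G B" and x: "0 < x"
  shows "sound_ratio \<gamma> g * psi_minus \<gamma> (x / g) + sound_ratio \<gamma> b * psi_minus \<gamma> (x / b)
           < psi_minus \<gamma> g + psi_minus \<gamma> b \<Longrightarrow> x < B * g"
    and "sound_ratio \<gamma> g * psi_minus \<gamma> (x / g) + sound_ratio \<gamma> b * psi_minus \<gamma> (x / b)
           > psi_minus \<gamma> g + psi_minus \<gamma> b \<Longrightarrow> x > B * g"
proof -
  have pos: "0 < g" "0 < b" "0 < G" "0 < B" and eq: "B * g = G * b"
    and E: "sound_ratio \<gamma> g * psi_minus \<gamma> B + sound_ratio \<gamma> b * psi_minus \<gamma> G
       = psi_minus \<gamma> g + psi_minus \<gamma> b"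
    using r by (auto simp: resolves_def)
  let ?L = "\<lambda>x. sound_ratio \<gamma> g * psi_minus \<gamma> (x / g) + sound_ratio \<gamma> b * psi_minus \<gamma> (x / b)"
  have at: "?L (B * g) = psi_minus \<gamma> g + psi_minus \<gamma> b"
  proof -
    have "B * g / g = B" using pos by simp
    moreover have "B * g / b = G" using pos eq by simp
    ultimately show ?thesis using E by simp
  qed
  have mono: "?L y < ?L z" if "0 < y" "y < z" for y z
    using that pos by (intro add_strict_mono mult_strict_left_mono psi_minus_strict_mono
        sound_ratio_pos divide_strict_right_mono) auto
  show "x < B * g" if "?L x < psi_minus \<gamma> g + psi_minus \<gamma> b"
    using that mono[of "B * g" x] at pos by (cases "B * g = x") (auto simp: not_less_iff_gr_or_eq linorder_neq_iff)
  show "x > B * g" if "?L x > psi_minus \<gamma> g + psi_minus \<gamma> b"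
    using that mono[of x "B * g"] at x by (cases "B * g = x") (auto simp: not_less_iff_gr_or_eq linorder_neq_iff)
qed

text \<open>
  Trial pressure \<open>g\<close>, at which \<open>B\<close> would be \<open>1\<close>.
\<close>

lemma transmitted_type:
  assumes r: "resolves \<gamma> g b G B"
  shows "b > 1 \<Longrightarrow> B > 1" "b < 1 \<Longrightarrow> B < 1"
proof -
  have pos: "0 < g" "0 < b" using r by (auto simp: resolves_def)
  show "B > 1" if "b > 1"
    using resolves_compare(1)[OF r pos(1)] velocity_jump_behind_shock[OF that pos(1)] pos by simp
  show "B < 1" if "b < 1"
    using resolves_compare(2)[OF r pos(1)] velocity_jump_behind_rarefaction[OF pos(2) that pos(1)] pos
    by simp
qed

text \<open>
  Trial pressure \<open>b * g\<close>: if the shocks kept their strengths, each velocity jump would be multiplied by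
  the sound ratio of the other shock, which exceeds \<open>1\<close>, and the sum would be more than the
  velocity difference available.
\<close>

lemma transmitted_shock_weaker:
  assumes r: "resolves \<gamma> g b G B" and "g > 1" "b > 1"
  shows "B < b" "G < g"
proof -
  have pos: "0 < g" "0 < b" and eq: "B * g = G * b" using r by (auto simp: resolves_def)
  have "1 * psi_minus \<gamma> b < sound_ratio \<gamma> g * psi_minus \<gamma> b"
    "1 * psi_minus \<gamma> g < sound_ratio \<gamma> b * psi_minus \<gamma> g"
    using assms by (intro mult_strict_right_mono sound_ratio_gt_1 psi_minus_pos; simp)+
  hence "B * g < b * g"
    using resolves_compare(2)[OF r, of "b * g"] pos by simp
  thus "B < b" using pos by simp
  show "G < g" using \<open>B * g < b * g\<close> pos unfolding eq by (simp add: mult.commute)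
qed

text \<open>
  Trial pressure \<open>b * g\<close> again: the shock now enters gas cooled by the rarefaction, and the rarefaction
  enters gas heated by the shock, so keeping the strengths gives too small a left side.
\<close>

lemma transmitted_shock_stronger:
  assumes r: "resolves \<gamma> g b G B" and "g > 1" "b < 1"
  shows "g < G"
proof -
  have pos: "0 < g" "0 < b" and eq: "B * g = G * b" using r by (auto simp: resolves_def)
  have "sound_ratio \<gamma> g * psi_minus \<gamma> b < 1 * psi_minus \<gamma> b"
    using assms pos by (intro mult_strict_right_mono_neg sound_ratio_gt_1 psi_minus_neg) auto
  moreover have "sound_ratio \<gamma> b * psi_minus \<gamma> g < 1 * psi_minus \<gamma> g"
    using assms pos by (intro mult_strict_right_mono sound_ratio_lt_1 psi_minus_pos) auto
  ultimately have "g * b < B * g"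
    using resolves_compare(1)[OF r, of "b * g"] pos by (simp add: mult.commute)
  thus ?thesis using pos eq by simp
qed

section \<open>The outgoing contact\<close>

text \<open>
  The quantity \<open>q * phi_minus q powr \<gamma>\<close> is the factor by which \<open>p * \<tau> powr \<gamma>\<close>, and with it the
  specific entropy, grows across a shock; here it is raised to the power \<open>1 / \<gamma>\<close>.  Its logarithmic
  derivative is a positive multiple of \<open>(q - 1)\<^sup>2\<close>.
\<close>

lemma shock_entropy_mono:
  assumes "1 < x" "x < y"
  shows "x powr (1 / \<gamma>) * phi_minus \<gamma> x < y powr (1 / \<gamma>) * phi_minus \<gamma> y"
proof -
  let ?a = "acoef \<gamma>"
  define S where "S q = 1 / \<gamma> * ln q + ln (1 + ?a * q) - ln (q + ?a)" for q
  have g1: "1 / \<gamma> = (1 - ?a) / (1 + ?a)" using gamma by (simp add: acoef_def divide_simps)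
  have exp_S: "q powr (1 / \<gamma>) * phi_minus \<gamma> q = exp (S q)" if "q > 1" for q
  proof -
    have "1 + ?a * q > 0" "q + ?a > 0" using that acoef_bounds by (auto intro: add_pos_pos)
    thus ?thesis using that
      by (simp add: S_def exp_add exp_diff phi_minus_def powr_def)
  qed
  have "S x < S y"
  proof (rule DERIV_pos_imp_increasing[OF assms(2)])
    fix q assume "x \<le> q" "q \<le> y"
    hence q: "q > 1" using assms by simp
    have pos: "1 + ?a * q > 0" "q + ?a > 0" "1 + ?a > 0" using q acoef_bounds by (auto intro: add_pos_pos)
    have "(S has_real_derivative (1 / \<gamma>) * (1 / q) + ?a / (1 + ?a * q) - 1 / (q + ?a)) (at q)"
      unfolding S_def using q pos gamma by (auto intro!: derivative_eq_intros)
    moreover have "(1 / \<gamma>) * (1 / q) + ?a / (1 + ?a * q) - 1 / (q + ?a)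
        = (1 - ?a) * ?a * (q - 1)\<^sup>2 / ((1 + ?a) * q * (1 + ?a * q) * (q + ?a))"
      unfolding g1 using pos q
      by (simp add: divide_simps) (simp add: power2_eq_square algebra_simps)
    moreover have "\<dots> > 0" using q pos acoef_bounds by (intro divide_pos_pos mult_pos_pos) auto
    ultimately show "\<exists>d. (S has_real_derivative d) (at q) \<and> 0 < d" by metis
  qed
  thus ?thesis using exp_S[of x] exp_S[of y] assms by simp
qed

text \<open>
  The two backward rarefactions are isentropic, so \<open>C powr \<gamma>\<close> compares the entropy factors of the
  outgoing and of the incoming forward shock, and the outgoing one is stronger.
\<close>

lemma contact_shock_rarefaction:
  assumes r: "resolves \<gamma> g b G B" and "g > 1" "b < 1"
  shows "contact \<gamma> g b G B > 1"
proof -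
  have pos: "0 < g" "0 < b" "0 < B" and eq: "B * g = G * b" using r by (auto simp: resolves_def)
  have B: "B < 1" using transmitted_type(2)[OF r] assms by simp
  have G: "g < G" by (rule transmitted_shock_stronger[OF assms])
  have "phi_minus \<gamma> b / phi_minus \<gamma> B = (B / b) powr (1 / \<gamma>)"
    using B assms pos by (simp add: phi_minus_def powr_divide powr_minus_divide)
  also have "B / b = G / g" using pos eq by (simp add: field_simps)
  also have "(G / g) powr (1 / \<gamma>) = G powr (1 / \<gamma>) / g powr (1 / \<gamma>)"
    using pos G by (simp add: powr_divide)
  finally have ratio: "phi_minus \<gamma> b / phi_minus \<gamma> B = G powr (1 / \<gamma>) / g powr (1 / \<gamma>)" .
  have "contact \<gamma> g b G B = phi_minus \<gamma> b / phi_minus \<gamma> B * (phi_minus \<gamma> G / phi_minus \<gamma> g)"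
    by (simp add: contact_def mult_ac)
  also have "\<dots> = (G powr (1 / \<gamma>) * phi_minus \<gamma> G) / (g powr (1 / \<gamma>) * phi_minus \<gamma> g)"
    unfolding ratio by simp
  finally have "contact \<gamma> g b G B
      = (G powr (1 / \<gamma>) * phi_minus \<gamma> G) / (g powr (1 / \<gamma>) * phi_minus \<gamma> g)" .
  moreover have "g powr (1 / \<gamma>) * phi_minus \<gamma> g > 0" using phi_minus_pos pos by simp
  ultimately show ?thesis using shock_entropy_mono[OF \<open>g > 1\<close> G] by simp
qed

lemma contact_rarefactions:
  assumes r: "resolves \<gamma> g b G B" and "g < 1" "b < 1"
  shows "contact \<gamma> g b G B = 1"
proof -
  have pos: "0 < g" "0 < b" "0 < B" "0 < G" and eq: "B * g = G * b" using r by (auto simp: resolves_def)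
  have "B < 1" "G < 1"
    using transmitted_type(2)[OF r] transmitted_type(2)[OF r[unfolded resolves_sym[of \<gamma> g]]] assms by auto
  hence "contact \<gamma> g b G B = (b * G) powr (- 1 / \<gamma>) / (g * B) powr (- 1 / \<gamma>)"
    using assms pos by (simp add: contact_def phi_minus_def powr_mult)
  thus ?thesis using eq pos by (simp add: mult.commute)
qed

lemma contact_pos: "resolves \<gamma> g b G B \<Longrightarrow> contact \<gamma> g b G B > 0"
  by (simp add: contact_def resolves_def phi_minus_pos)

text \<open>
  As \<open>b / g = B / G = k\<close>, the contact strength is \<open>R g / R G\<close> for \<open>R t = phi_minus (k * t) / phi_minus t\<close>.
  The dependence of \<open>R\<close> on \<open>t\<close> is through \<open>k * t + 1 / t\<close> alone, in which \<open>R\<close> increases and which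
  itself increases for \<open>t > 1\<close>.  The shocks weaken each other, so \<open>G < g\<close> and \<open>R G < R g\<close>.
\<close>

lemma contact_unequal_shocks:
  assumes r: "resolves \<gamma> g b G B" and "1 < g" "g < b"
  shows "contact \<gamma> g b G B > 1"
proof -
  let ?a = "acoef \<gamma>"
  have pos: "0 < g" "0 < b" and eq: "B * g = G * b" using r by (auto simp: resolves_def)
  define k where "k = b / g"
  have k: "k > 1" and b: "b = k * g" using assms by (auto simp: k_def)
  have B: "B = k * G" using pos eq by (simp add: k_def field_simps)
  have G: "1 < G" "G < g"
    using transmitted_type(1)[OF r[unfolded resolves_sym[of \<gamma> g]]] transmitted_shock_weaker(2)[OF r] assms
    by auto
  have pp: "1 + ?a * q > 0" "q + ?a > 0" if "q > 1" for q
    using that acoef_bounds by (auto intro: add_pos_pos)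
  have ratio: "phi_minus \<gamma> (k * t) / phi_minus \<gamma> t
      = 1 - (k - 1) * (1 - ?a\<^sup>2) / (?a * (k * t + 1 / t) + k + ?a\<^sup>2)" if t: "t > 1" for t
  proof -
    have kt: "k * t > 1" using k t by (simp add: less_1_mult)
    have den: "?a * (k * t + 1 / t) + k + ?a\<^sup>2 = (k * t + ?a) * (1 + ?a * t) / t"
      using t by (simp add: field_simps power2_eq_square)
    show ?thesis
      unfolding den using pp[OF t] pp[OF kt] t kt
      by (simp add: phi_minus_def divide_simps) (simp add: power2_eq_square algebra_simps)
  qed
  have "k * G + 1 / G < k * g + 1 / g"
  proof -
    have "1 < k * (g * G)" using k assms G by (intro less_1_mult) auto
    hence "0 < (g - G) * (k * (g * G) - 1) / (g * G)" using G assms by (intro divide_pos_pos mult_pos_pos) auto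
    also have "\<dots> = k * g + 1 / g - (k * G + 1 / G)" using G assms by (simp add: field_simps)
    finally show ?thesis by simp
  qed
  hence "?a * (k * G + 1 / G) + k + ?a\<^sup>2 < ?a * (k * g + 1 / g) + k + ?a\<^sup>2"
    using acoef_bounds by simp
  moreover have "0 < ?a * (k * G + 1 / G) + k + ?a\<^sup>2"
  proof -
    have "0 \<le> ?a * (k * G + 1 / G)" using k G acoef_bounds by simp
    thus ?thesis using k by (simp add: add_nonneg_pos add_pos_nonneg)
  qed
  moreover have "0 < k - 1" "0 < 1 - ?a\<^sup>2"
    using k acoef_bounds by (simp_all add: power_less_one_iff)
  ultimately have "(k - 1) * (1 - ?a\<^sup>2) / (?a * (k * g + 1 / g) + k + ?a\<^sup>2)
      < (k - 1) * (1 - ?a\<^sup>2) / (?a * (k * G + 1 / G) + k + ?a\<^sup>2)"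
    by (intro divide_strict_left_mono mult_pos_pos; linarith)
  hence "phi_minus \<gamma> B / phi_minus \<gamma> G < phi_minus \<gamma> b / phi_minus \<gamma> g"
    using ratio[of g] ratio[of G] assms G b B by simp
  moreover have "phi_minus \<gamma> q > 0" if "q \<in> {b, g, B, G}" for q
    using that r phi_minus_pos by (auto simp: resolves_def)
  ultimately show ?thesis by (simp add: contact_def field_simps)
qed

lemma contact_shocks:
  assumes r: "resolves \<gamma> g b G B" and "g > 1" "b > 1"
  shows "contact \<gamma> g b G B > 1 \<longleftrightarrow> b > g" "contact \<gamma> g b G B < 1 \<longleftrightarrow> b < g"
proof -
  have less: "contact \<gamma> g b G B < 1" if "b < g"
  proof -
    have "contact \<gamma> b g B G > 1"
      by (rule contact_unequal_shocks[OF r[unfolded resolves_sym[of \<gamma> g]] \<open>b > 1\<close> that])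
    thus ?thesis using contact_pos[OF r] by (simp add: contact_swap[of \<gamma> b g])
  qed
  have equal: "contact \<gamma> g b G B = 1" if "b = g"
  proof -
    have "B = G" using that r by (auto simp: resolves_def)
    moreover have "phi_minus \<gamma> g \<noteq> 0" "phi_minus \<gamma> G \<noteq> 0"
      using r phi_minus_pos[of g] phi_minus_pos[of G] by (auto simp: resolves_def)
    ultimately show ?thesis using that by (simp add: contact_def)
  qed
  have greater: "contact \<gamma> g b G B > 1" if "g < b"
    by (rule contact_unequal_shocks[OF r \<open>g > 1\<close> that])
  have "(contact \<gamma> g b G B > 1 \<longleftrightarrow> b > g) \<and> (contact \<gamma> g b G B < 1 \<longleftrightarrow> b < g)"
  proof (cases b g rule: linorder_cases)
    case *: less
    show ?thesis using less[OF *] * by linarith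
  next
    case *: equal
    show ?thesis using equal[OF *] * by linarith
  next
    case *: greater
    show ?thesis using greater[OF *] * by linarith
  qed
  thus "contact \<gamma> g b G B > 1 \<longleftrightarrow> b > g" "contact \<gamma> g b G B < 1 \<longleftrightarrow> b < g" by auto
qed

section \<open>Reduction of the Riemann problem and vacuum formation\<close>

lemma sound_ratio_reflect:
  "f > 0 \<Longrightarrow> sqrt (phi_plus \<gamma> f * f) = 1 / sound_ratio \<gamma> (1 / f)"
  by (simp add: sound_ratio_def phi_plus_reflect real_sqrt_divide real_sqrt_mult)

lemma outgoing_resolves:
  assumes "0 < \<tau>" "0 < p" "0 < f" "0 < b" "0 < B" "0 < C" "0 < F"
    and eq: "W_minus \<gamma> b (W_plus \<gamma> f (\<tau>, u, p)) = W_plus \<gamma> F (J C (W_minus \<gamma> B (\<tau>, u, p)))"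
  shows "resolves \<gamma> (1 / f) b (1 / F) B" "C = contact \<gamma> (1 / f) b (1 / F) B"
proof -
  define g where "g = 1 / f"
  define G where "G = 1 / F"
  have g: "g > 0" "f = 1 / g" and G: "G > 0" "F = 1 / G" using assms by (auto simp: g_def G_def)
  let ?h = "sound_ratio \<gamma>" and ?s = "psi_minus \<gamma>" and ?\<phi> = "phi_minus \<gamma>"
  have "f * b = F * B" using eq assms by (simp add: W_minus_def W_plus_def J_def mult.commute)
  hence BG: "B * g = G * b" using g G by (simp add: field_simps)
  have "?\<phi> b * phi_plus \<gamma> f = phi_plus \<gamma> F * C * ?\<phi> B"
    using eq assms by (simp add: W_minus_def W_plus_def J_def)
  hence "?\<phi> b / ?\<phi> g = C * ?\<phi> B / ?\<phi> G"
    using g G by (simp add: phi_plus_reflect)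
  moreover have "?\<phi> g > 0" "?\<phi> G > 0" "?\<phi> B > 0" using g G assms phi_minus_pos by auto
  ultimately have C: "C = contact \<gamma> g b G B" by (simp add: contact_def field_simps)
  have hp: "?h g > 0" "?h G > 0" using g G sound_ratio_pos by auto
  \<comment> \<open>The sound ratio between the contact and the forward wave, computed from the right instead of
    from the left; this eliminates \<open>C\<close> from the velocity equation.\<close>
  have mid: "sqrt (C * ?\<phi> B * B) = ?h b * ?h G / ?h g"
  proof -
    have "B = G * b / g" using BG g by (simp add: field_simps)
    hence "C * ?\<phi> B * B = (b * ?\<phi> b) * (G * ?\<phi> G) / (g * ?\<phi> g)"
      using C \<open>?\<phi> B > 0\<close> by (simp add: contact_def field_simps)
    thus ?thesis by (simp add: sound_ratio_def real_sqrt_mult real_sqrt_divide)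
  qed
  have "psi_plus \<gamma> f * sqrt (\<tau> * p) - ?s b * sqrt (phi_plus \<gamma> f * \<tau> * (f * p))
      = - ?s B * sqrt (\<tau> * p) + psi_plus \<gamma> F * sqrt (C * (?\<phi> B * \<tau>) * (B * p))"
    using eq by (simp add: W_minus_def W_plus_def J_def algebra_simps)
  moreover have "sqrt (phi_plus \<gamma> f * \<tau> * (f * p)) = sqrt (phi_plus \<gamma> f * f) * sqrt (\<tau> * p)"
    "sqrt (C * (?\<phi> B * \<tau>) * (B * p)) = sqrt (C * ?\<phi> B * B) * sqrt (\<tau> * p)"
    by (simp_all only: real_sqrt_mult[symmetric] ac_simps)
  ultimately have "(psi_plus \<gamma> f - ?s b * sqrt (phi_plus \<gamma> f * f)) * sqrt (\<tau> * p)
      = (- ?s B + psi_plus \<gamma> F * sqrt (C * ?\<phi> B * B)) * sqrt (\<tau> * p)"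
    by (simp add: algebra_simps)
  hence "psi_plus \<gamma> f - ?s b * (1 / ?h g) = - ?s B + psi_plus \<gamma> F * (?h b * ?h G / ?h g)"
    using assms sound_ratio_reflect[OF \<open>0 < f\<close>] unfolding mid by (simp add: g_def)
  hence "psi_plus \<gamma> f * ?h g - ?s b = - ?s B * ?h g + (psi_plus \<gamma> F * ?h G) * ?h b"
    using hp by (simp add: field_simps)
  hence "- ?s g - ?s b = - ?s B * ?h g - ?s G * ?h b"
    using psi_plus_reflect[OF g(1)] psi_plus_reflect[OF G(1)] g G by simp
  hence "resolves \<gamma> g b G B" using assms g G BG by (simp add: resolves_def algebra_simps)
  thus "resolves \<gamma> (1 / f) b (1 / F) B" "C = contact \<gamma> (1 / f) b (1 / F) B"
    using C by (simp_all add: g_def G_def)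
qed

text \<open>
  The left side is the velocity difference that the two outgoing rarefactions produce when they both
  reach zero pressure, the right side the one that is imposed, in units of \<open>sqrt (\<tau> * p)\<close> at the middle
  state.
\<close>

lemma vacuum_iff:
  assumes "0 < \<tau>" "0 < p" "0 < f" "0 < b"
  shows "vacuum \<gamma> (\<tau>, u, p) (W_minus \<gamma> b (W_plus \<gamma> f (\<tau>, u, p))) \<longleftrightarrow>
    nu \<gamma> * (sound_ratio \<gamma> (1 / f) + sound_ratio \<gamma> b) \<le> - (psi_minus \<gamma> (1 / f) + psi_minus \<gamma> b)"
proof -
  define g where "g = 1 / f"
  have g: "g > 0" "f = 1 / g" using assms by (auto simp: g_def)
  let ?h = "sound_ratio \<gamma>" and ?s = "psi_minus \<gamma>" and ?\<phi> = "phi_minus \<gamma>"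
  \<comment> \<open>\<open>sqrt (\<tau> * p)\<close> at the middle state\<close>
  define S where "S = sqrt (\<tau> * p) / ?h g"
  have hp: "?h g > 0" using g sound_ratio_pos by auto
  have S: "S > 0" using assms hp by (simp add: S_def)
  have l: "sqrt (\<tau> * p) = ?h g * S" using hp by (simp add: S_def)
  have m: "sqrt (phi_plus \<gamma> f * \<tau> * (f * p)) = S"
  proof -
    have "sqrt (phi_plus \<gamma> f * \<tau> * (f * p)) = sqrt (phi_plus \<gamma> f * f) * sqrt (\<tau> * p)"
      by (simp only: real_sqrt_mult[symmetric] ac_simps)
    thus ?thesis using sound_ratio_reflect[OF \<open>0 < f\<close>] by (simp add: S_def g_def)
  qed
  have r: "sqrt (?\<phi> b * (phi_plus \<gamma> f * \<tau>) * (b * (f * p))) = ?h b * S"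
    unfolding m[symmetric] sound_ratio_def by (simp only: real_sqrt_mult[symmetric] ac_simps)
  have u: "psi_plus \<gamma> f * (?h g * S) = - ?s g * S"
    using psi_plus_reflect[OF g(1)] g by (simp add: mult.assoc[symmetric])
  have gl: "sqrt (\<gamma> * x * y) = sqrt \<gamma> * sqrt (x * y)" for x y
    by (simp add: real_sqrt_mult mult.assoc)
  have "vacuum \<gamma> (\<tau>, u, p) (W_minus \<gamma> b (W_plus \<gamma> f (\<tau>, u, p))) \<longleftrightarrow>
    nu \<gamma> * (?h g * S + ?h b * S) \<le> - ?s g * S - ?s b * S"
    unfolding vacuum_def W_minus_def W_plus_def prod.case gl r m l u nu_eq
    by (auto simp: not_less algebra_simps)
  also have "\<dots> \<longleftrightarrow> (nu \<gamma> * (?h g + ?h b)) * S \<le> (- (?s g + ?s b)) * S"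
    by (auto simp: algebra_simps)
  also have "\<dots> \<longleftrightarrow> nu \<gamma> * (?h g + ?h b) \<le> - (?s g + ?s b)"
    using S by simp
  finally show ?thesis by (simp add: g_def)
qed

text \<open>
  A rarefaction can supply a velocity difference of at most \<open>nu\<close>, the shock reduces it, and the shock
  raises \<open>sound_ratio (1 / f)\<close> above \<open>1\<close>.
\<close>

lemma no_vacuum_behind_forward_shock:
  assumes "0 < \<tau>" "0 < p" "0 < f" "f < 1" "0 < b"
  shows "\<not> vacuum \<gamma> (\<tau>, u, p) (W_minus \<gamma> b (W_plus \<gamma> f (\<tau>, u, p)))"
proof -
  let ?g = "1 / f"
  have g: "?g > 1" using assms by simp
  have "- psi_minus \<gamma> b < nu \<gamma> * 1"
  proof (cases "b \<le> 1")
    case True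
    have "nu \<gamma> * b powr zeta \<gamma> > 0" using nu_pos assms by simp
    thus ?thesis using True by (simp add: psi_minus_def algebra_simps)
  next
    case False
    thus ?thesis using psi_minus_pos[of b] nu_pos by simp
  qed
  also have "\<dots> < nu \<gamma> * (sound_ratio \<gamma> ?g + sound_ratio \<gamma> b)"
    using sound_ratio_gt_1[OF g] sound_ratio_pos[OF \<open>0 < b\<close>] nu_pos by (intro mult_strict_left_mono) auto
  finally show ?thesis
    using psi_minus_pos[OF g] unfolding vacuum_iff[OF assms(1-3) assms(5)] by linarith
qed

lemma vacuum_rarefactions_iff:
  assumes "0 < \<tau>" "0 < p" "1 < f" "0 < b" "b < 1"
  shows "vacuum \<gamma> (\<tau>, u, p) (W_minus \<gamma> b (W_plus \<gamma> f (\<tau>, u, p))) \<longleftrightarrow>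
    b powr zeta \<gamma> + f powr (- zeta \<gamma>) \<le> 1"
proof -
  let ?w = "b powr zeta \<gamma> + f powr (- zeta \<gamma>)"
  have g: "(1 / f) powr zeta \<gamma> = f powr (- zeta \<gamma>)"
    using assms by (simp add: powr_divide powr_minus_divide)
  have "vacuum \<gamma> (\<tau>, u, p) (W_minus \<gamma> b (W_plus \<gamma> f (\<tau>, u, p))) \<longleftrightarrow>
      nu \<gamma> * ?w \<le> nu \<gamma> * (2 - ?w)"
    using assms vacuum_iff[of \<tau> p f b u]
    by (simp add: sound_ratio_rarefaction psi_minus_def g algebra_simps)
  also have "\<dots> \<longleftrightarrow> ?w \<le> 2 - ?w" using nu_pos by simp
  finally show ?thesis by auto
qed

text \<open>
  Two rarefactions leave \<open>p * \<tau> powr \<gamma>\<close> unchanged; hence no entropy jump is recorded across a vacuum.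
\<close>

lemma vacuum_entropy_jump_rarefactions:
  assumes "0 < \<tau>" "0 < p" "1 < f" "0 < b" "b < 1"
  shows "(b * (f * p)) * (phi_minus \<gamma> b * (phi_plus \<gamma> f * \<tau>)) powr \<gamma> = p * \<tau> powr \<gamma>"
proof -
  have "phi_minus \<gamma> b powr \<gamma> = b powr (-1)" "phi_plus \<gamma> f powr \<gamma> = f powr (-1)"
    using assms gamma by (simp_all add: phi_minus_def phi_plus_def powr_powr)
  hence "(phi_minus \<gamma> b * (phi_plus \<gamma> f * \<tau>)) powr \<gamma> = (1 / b) * ((1 / f) * \<tau> powr \<gamma>)"
    using assms by (simp add: powr_mult powr_minus_divide)
  thus ?thesis using assms by simp
qed

end

section \<open>Head-on interactions\<close>

theorem theorem3p2:
  fixes \<gamma> f b :: real and Ul Um Ur :: state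
  assumes "\<gamma> > 1"
    and "Ia f b \<or> Ib f b \<or> Ic f b"
    and "Ul \<in> states"
    and "Um = W_plus \<gamma> f Ul"
    and "Ur = W_minus \<gamma> b Um"
  shows "(\<forall>(B::real) (C::real) (F::ereal). outgoing \<gamma> Ul Ur B C F \<longrightarrow>
            ((B > 1 \<longleftrightarrow> b > 1) \<and> (B < 1 \<longleftrightarrow> b < 1)) \<and>
            ((F > 1 \<longleftrightarrow> f > 1) \<and> (F < 1 \<longleftrightarrow> f < 1)) \<and>
            ((Ia f b \<longrightarrow> (C > 1 \<longleftrightarrow> b * f > 1) \<and> (C < 1 \<longleftrightarrow> b * f < 1)) \<and>
             (Ib f b \<longrightarrow> C > 1) \<and>
             (Ic f b \<longrightarrow> C = 1))) \<and>
         ((Ia f b \<or> Ib f b \<longrightarrow> \<not> vacuum \<gamma> Ul Ur) \<and>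
          (Ic f b \<longrightarrow> (vacuum \<gamma> Ul Ur \<longleftrightarrow> b powr zeta \<gamma> + f powr (- zeta \<gamma>) \<le> 1)))"
proof -
  obtain \<tau> u p where Ul: "Ul = (\<tau>, u, p)" and pos: "0 < \<tau>" "0 < p"
    using assms(3) by (auto simp: states_def)
  have Ur: "Ur = W_minus \<gamma> b (W_plus \<gamma> f (\<tau>, u, p))" using assms(4,5) Ul by simp
  have fb: "0 < f" "0 < b" and bne: "b > 1 \<or> b < 1" and fne: "f > 1 \<or> f < 1"
    using assms(2) by (auto simp: Ia_def Ib_def Ic_def)
  have no_vacuum: "\<not> vacuum \<gamma> Ul Ur" if "Ia f b \<or> Ib f b"
    using that no_vacuum_behind_forward_shock[OF assms(1) pos] unfolding Ul Ur by (auto simp: Ia_def Ib_def)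
  have vac: "vacuum \<gamma> Ul Ur \<longleftrightarrow> b powr zeta \<gamma> + f powr (- zeta \<gamma>) \<le> 1" if "Ic f b"
    using that vacuum_rarefactions_iff[OF assms(1) pos] unfolding Ul Ur by (auto simp: Ic_def)
  have "((B > 1 \<longleftrightarrow> b > 1) \<and> (B < 1 \<longleftrightarrow> b < 1)) \<and>
            ((F > 1 \<longleftrightarrow> f > 1) \<and> (F < 1 \<longleftrightarrow> f < 1)) \<and>
            ((Ia f b \<longrightarrow> (C > 1 \<longleftrightarrow> b * f > 1) \<and> (C < 1 \<longleftrightarrow> b * f < 1)) \<and>
             (Ib f b \<longrightarrow> C > 1) \<and>
             (Ic f b \<longrightarrow> C = 1))"
    if out: "outgoing \<gamma> Ul Ur B C F" for B C :: real and F :: ereal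
  proof (cases "vacuum \<gamma> Ul Ur")
    case True
    hence ic: "Ic f b" using no_vacuum assms(2) by blast
    have BF: "B = 0" "F = \<infinity>" and
      C: "C = ((b * (f * p)) * (phi_minus \<gamma> b * (phi_plus \<gamma> f * \<tau>)) powr \<gamma> / (p * \<tau> powr \<gamma>)) powr (1 / \<gamma>)"
      using out True unfolding outgoing_def Ul Ur W_minus_def W_plus_def by auto
    have "C = 1"
      using ic pos unfolding C by (subst vacuum_entropy_jump_rarefactions[OF assms(1)]) (auto simp: Ic_def)
    thus ?thesis using ic BF by (auto simp: Ia_def Ib_def Ic_def)
  next
    case False
    then obtain F' where F: "F = ereal F'" and out_pos: "0 < B" "0 < C" "0 < F'"
      and eq: "W_minus \<gamma> b (W_plus \<gamma> f (\<tau>, u, p)) = W_plus \<gamma> F' (J C (W_minus \<gamma> B (\<tau>, u, p)))"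
      using out unfolding outgoing_def Ul Ur by auto
    note r = outgoing_resolves[OF assms(1) pos fb out_pos eq]
    have r': "resolves \<gamma> b (1 / f) B (1 / F')" using r(1) resolves_sym by blast
    have i: "b > 1 \<Longrightarrow> B > 1" "b < 1 \<Longrightarrow> B < 1" using transmitted_type[OF assms(1) r(1)] by auto
    have ii: "f < 1 \<Longrightarrow> F' < 1" "f > 1 \<Longrightarrow> F' > 1"
      using transmitted_type[OF assms(1) r'] fb out_pos by auto
    have "C > 1 \<longleftrightarrow> b * f > 1" "C < 1 \<longleftrightarrow> b * f < 1" if "Ia f b"
      using contact_shocks[OF assms(1) r(1)] that fb unfolding r(2) by (auto simp: Ia_def field_simps)
    moreover have "C > 1" if "Ib f b"
      using contact_shock_rarefaction[OF assms(1) r(1)] that unfolding r(2) by (auto simp: Ib_def)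
    moreover have "C = 1" if "Ic f b"
      using contact_rarefactions[OF assms(1) r(1)] that unfolding r(2) by (auto simp: Ic_def)
    moreover have "(B > 1 \<longleftrightarrow> b > 1) \<and> (B < 1 \<longleftrightarrow> b < 1)" using i bne by auto
    moreover have "(F > 1 \<longleftrightarrow> f > 1) \<and> (F < 1 \<longleftrightarrow> f < 1)" using ii fne by (auto simp: F)
    ultimately show ?thesis by blast
  qed
  thus ?thesis using no_vacuum vac by blast
qed

end
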